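(* Let $\epsilon\in(0,1)$. Suppose that $f$ is a single-valley-extended solution with platforms of the second type of FKS equation. Let $[u,v]$ be the interval consisting of all minimum points of $f$, and suppose $f(\epsilon^2)<u$. Then $$g(x)=\operatorname{sgn}(v-|x|)\,f(|x|),\qquad x\in[-1,1],$$ is an even solution of the FKS equation. Conversely, if $g$ is an even solution of the FKS equation, then $f(x)=|g(x)|$, $x\in[0,1]$, is a solution of the second type of FKS equation.
   Context: Fix $\epsilon\in(0,1)$. An even solution of the FKS equation is an even function $g:[-1,1]\to[-1,1]$ with $$g(g(\epsilon^2x))=-\epsilon g(x)\ \text{ for all } x\in[-1,1],\qquad g(0)=1.$$ A solution of the second type of FKS equation is a function $f:[0,1]\to[0,1]$ with $$f(f(\epsilon^2x))=\epsilon f(x)\ \text{ for all } x\in[0,1],\qquad f(0)=1.$$ A function $f$ on an interval $[c,d]$ is a single-valley function with a platform if there is a subinterval $[u,v]\subset[c,d]$ with $u<v$ such that $f$ is strictly decreasing on $[c,u]$, constant on $[u,v]$, and strictly increasing on $[v,d]$. A single-valley-extended solution with platforms is a continuous solution $f:[0,1]\to[0,1]$ of the second type of FKS equation whose restriction to $[\epsilon^2,1]$ is a single-valley function with a platform. A minimum point of $f$ is a point of $[0,1]$ at which $f$ attains its minimum over $[0,1]$. Here $\operatorname{sgn}(0)=0$, $\operatorname{sgn}(t)=1$ for $t>0$ and $\operatorname{sgn}(t)=-1$ for $t<0$. *)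

theory Defs
  imports "HOL-Analysis.Analysis"
begin

(* Functions on an interval are total functions on the reals; every condition is
   relativised to that interval, so values outside it are irrelevant. *)

definition even_FKS_solution :: "real \<Rightarrow> (real \<Rightarrow> real) \<Rightarrow> bool" where
  "even_FKS_solution eps g \<longleftrightarrow>
     g ` {-1..1} \<subseteq> {-1..1} \<and>
     (\<forall>x\<in>{-1..1}. g (- x) = g x) \<and>
     (\<forall>x\<in>{-1..1}. g (g (eps\<^sup>2 * x)) = - eps * g x) \<and>
     g 0 = 1"

definition FKS2_solution :: "real \<Rightarrow> (real \<Rightarrow> real) \<Rightarrow> bool" where
  "FKS2_solution eps f \<longleftrightarrow>
     f ` {0..1} \<subseteq> {0..1} \<and>
     (\<forall>x\<in>{0..1}. f (f (eps\<^sup>2 * x)) = eps * f x) \<and>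
     f 0 = 1"

definition single_valley_platform :: "real \<Rightarrow> real \<Rightarrow> (real \<Rightarrow> real) \<Rightarrow> bool" where
  "single_valley_platform c d f \<longleftrightarrow>
     (\<exists>u v. u < v \<and> {u..v} \<subseteq> {c..d} \<and>
        strict_antimono_on {c..u} f \<and> f constant_on {u..v} \<and> strict_mono_on {v..d} f)"

definition single_valley_extended_platform_solution :: "real \<Rightarrow> (real \<Rightarrow> real) \<Rightarrow> bool" where
  "single_valley_extended_platform_solution eps f \<longleftrightarrow>
     FKS2_solution eps f \<and> continuous_on {0..1} f \<and> single_valley_platform (eps\<^sup>2) 1 f"

definition minimum_points :: "(real \<Rightarrow> real) \<Rightarrow> real set" where
  "minimum_points f = {x. is_arg_min f (\<lambda>y. y \<in> {0..1}) x}"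

end

theory Submission
  imports Defs
begin

text \<open>
  The functional equation at a minimum point forces the minimum of \<open>f\<close> to be \<open>0\<close>, so \<open>{u..v}\<close> is
  the zero set of \<open>f\<close>. Hence \<open>x\<close> is a zero of \<open>f\<close> iff \<open>f (eps\<^sup>2 * x) \<in> {u..v}\<close>, and zeros lie
  above \<open>eps\<^sup>2\<close>. As \<open>f 0 = 1 > v\<close> and \<open>f (eps\<^sup>2) < u\<close>, the intermediate value theorem shows
  that \<open>f (eps\<^sup>2 * x)\<close> is above \<open>v\<close> to the left of \<open>u\<close> and below \<open>v\<close> to the right of \<open>v\<close>;
  this is precisely the sign change in the even equation.
\<close>

lemma FKS2_scaled_mem:
  fixes eps x :: real
  assumes "0 < eps" "eps < 1" "x \<in> {0..1}"
  shows "eps\<^sup>2 * x \<in> {0..1}"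
  using assms by (auto intro!: mult_le_one power_le_one)

text \<open>Continuity gives a minimum point \<open>p\<close>. Since \<open>eps * f p\<close> is
  again a value of \<open>f\<close>, taken at \<open>f (eps\<^sup>2 * p)\<close>, minimality yields
  \<open>f p \<le> eps * f p\<close>, which excludes \<open>f p > 0\<close>.\<close>

lemma FKS2_minimum_points_eq_zeros:
  assumes eps: "0 < eps" "eps < 1" and sol: "FKS2_solution eps f"
    and cont: "continuous_on {0..1} f"
  shows "minimum_points f = {x \<in> {0..1}. f x = 0}" and "minimum_points f \<noteq> {}"
proof -
  have nonneg: "0 \<le> f x" if "x \<in> {0..1}" for x
    using sol that by (auto simp: FKS2_solution_def image_subset_iff)
  have "\<exists>p\<in>{0..1}. \<forall>y\<in>{0..1}. f p \<le> f y"
    by (rule continuous_attains_inf) (use cont in auto)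
  then obtain p where p: "p \<in> {0..1}" and p_min: "\<And>y. y \<in> {0..1} \<Longrightarrow> f p \<le> f y"
    by blast
  have "f (eps\<^sup>2 * p) \<in> {0..1}"
    using sol FKS2_scaled_mem[OF eps p] unfolding FKS2_solution_def by blast
  then have "f p \<le> eps * f p"
    using p_min sol p by (metis FKS2_solution_def)
  moreover have "eps * f p < f p" if "0 < f p"
    using eps that by simp
  ultimately have "f p = 0"
    using nonneg[OF p] by (metis less_eq_real_def not_le)
  with p p_min nonneg show "minimum_points f = {x \<in> {0..1}. f x = 0}"
    unfolding minimum_points_def is_arg_min_linorder by force
  with p \<open>f p = 0\<close> show "minimum_points f \<noteq> {}"
    by blast
qed

lemma even_FKS_solution_of_FKS2_solution:
  assumes eps: "0 < eps" "eps < 1" and sol: "FKS2_solution eps f"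
    and cont: "continuous_on {0..1} f"
    and min: "minimum_points f = {u..v}" and less: "f (eps\<^sup>2) < u"
  shows "even_FKS_solution eps (\<lambda>x. sgn (v - \<bar>x\<bar>) * f \<bar>x\<bar>)"
proof -
  note scaled = FKS2_scaled_mem[OF eps]
  have rng: "0 \<le> f x" "f x \<le> 1" if "x \<in> {0..1}" for x
    using sol that by (auto simp: FKS2_solution_def image_subset_iff)
  have eq: "f (f (eps\<^sup>2 * x)) = eps * f x" if "x \<in> {0..1}" for x
    using sol that by (auto simp: FKS2_solution_def)
  have f0: "f 0 = 1" using sol by (simp add: FKS2_solution_def)
  have f1: "f 1 = eps" using eq[of 0] f0 by simp
  have zeros: "x \<in> {u..v} \<longleftrightarrow> x \<in> {0..1} \<and> f x = 0" for x
    using FKS2_minimum_points_eq_zeros(1)[OF eps sol cont] min by blast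
  have uv: "u \<le> v"
    using FKS2_minimum_points_eq_zeros(2)[OF eps sol cont] min by simp
  have v: "v \<in> {0..1}" "f v = 0" using zeros[of v] uv by auto
  have "v < 1" using v f1 eps by (cases "v = 1") auto
  have "0 < v" using v f0 by (cases "v = 0") auto
  \<comment> \<open>Otherwise \<open>v\<close> is a scaled point \<open>eps\<^sup>2 * y\<close>, and
    the equation at \<open>y\<close> reads \<open>f (f v) = f 0 = 1\<close> on the left but is at
    most \<open>eps\<close> on the right. This bound makes the sign factor equal to 1 at every
    scaled argument.\<close>
  have v_gt: "eps\<^sup>2 < v"
  proof (rule ccontr)
    assume "\<not> eps\<^sup>2 < v"
    define y where "y = v / eps\<^sup>2"
    have y: "y \<in> {0..1}" "eps\<^sup>2 * y = v"
      using \<open>\<not> eps\<^sup>2 < v\<close> v eps by (auto simp: y_def field_simps)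
    have "1 = eps * f y" using eq[OF y(1)] y(2) v(2) f0 by simp
    moreover have "eps * f y \<le> eps"
      using rng[OF y(1)] eps by (simp add: mult_left_le)
    ultimately show False using eps by linarith
  qed
  have cont_scaled: "continuous_on {a..b} (\<lambda>x. f (eps\<^sup>2 * x))" if "0 \<le> a" "b \<le> 1" for a b
  proof (rule continuous_on_compose2[OF cont])
    show "continuous_on {a..b} (\<lambda>x. eps\<^sup>2 * x)" by (intro continuous_intros)
    show "(\<lambda>x. eps\<^sup>2 * x) ` {a..b} \<subseteq> {0..1}" using scaled that by force
  qed
  \<comment> \<open>Here \<open>eps * f z = f v = 0\<close>, so the level \<open>v\<close> can be
    met only over the platform.\<close>
  have hits_v: "z \<in> {u..v}" if "z \<in> {0..1}" "f (eps\<^sup>2 * z) = v" for z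
    using eq[OF that(1)] that v(2) eps zeros[of z] by simp
  have left: "v < f (eps\<^sup>2 * x)" if x: "x \<in> {0..1}" "x < u" for x
  proof (rule ccontr)
    assume "\<not> v < f (eps\<^sup>2 * x)"
    then have "\<exists>z\<ge>0. z \<le> x \<and> f (eps\<^sup>2 * z) = v"
      using x v f0 by (intro IVT2' cont_scaled) auto
    then obtain z where "0 \<le> z" "z \<le> x" "f (eps\<^sup>2 * z) = v" by blast
    then show False using hits_v[of z] x by auto
  qed
  \<comment> \<open>The right endpoint 1 is the anchor: the scaled function takes there the value
    \<open>f (eps\<^sup>2) < u \<le> v\<close>.\<close>
  have right: "f (eps\<^sup>2 * x) < v" if x: "x \<in> {0..1}" "v < x" for x
  proof (rule ccontr)
    assume "\<not> f (eps\<^sup>2 * x) < v"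
    then have "\<exists>z\<ge>x. z \<le> 1 \<and> f (eps\<^sup>2 * z) = v"
      using x less uv by (intro IVT2' cont_scaled) auto
    then obtain z where "x \<le> z" "z \<le> 1" "f (eps\<^sup>2 * z) = v" by blast
    then show False using hits_v[of z] x by auto
  qed
  \<comment> \<open>The factor \<open>f x\<close> is kept because the two signs may disagree on
    \<open>{u..v}\<close>, where it vanishes.\<close>
  have sign: "sgn (v - f (eps\<^sup>2 * x)) * f x = - sgn (v - x) * f x" if "x \<in> {0..1}" for x
    using left[OF that] right[OF that] zeros[of x] that uv
    by (cases "x < u"; cases "v < x") auto
  let ?g = "\<lambda>x. sgn (v - \<bar>x\<bar>) * f \<bar>x\<bar>"
  have bounded: "?g x \<in> {-1..1}" if "x \<in> {-1..1}" for x
  proof -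
    have "0 \<le> f \<bar>x\<bar>" "f \<bar>x\<bar> \<le> 1" using rng[of "\<bar>x\<bar>"] that by auto
    then show ?thesis by (auto simp: sgn_if)
  qed
  have "?g (?g (eps\<^sup>2 * x)) = - eps * ?g x" if "x \<in> {-1..1}" for x
  proof -
    have x: "\<bar>x\<bar> \<in> {0..1}" using that by auto
    have abs: "\<bar>eps\<^sup>2 * x\<bar> = eps\<^sup>2 * \<bar>x\<bar>" by (simp add: abs_mult)
    have "eps\<^sup>2 * \<bar>x\<bar> \<le> eps\<^sup>2" using x by (simp add: mult_left_le)
    then have "?g (eps\<^sup>2 * x) = f (eps\<^sup>2 * \<bar>x\<bar>)"
      using v_gt abs by simp
    moreover have "\<bar>f (eps\<^sup>2 * \<bar>x\<bar>)\<bar> = f (eps\<^sup>2 * \<bar>x\<bar>)"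
      using rng(1)[OF scaled[OF x]] by simp
    ultimately have "?g (?g (eps\<^sup>2 * x)) = eps * (sgn (v - f (eps\<^sup>2 * \<bar>x\<bar>)) * f \<bar>x\<bar>)"
      using eq[OF x] by simp
    then show ?thesis using sign[OF x] by simp
  qed
  then show ?thesis
    unfolding even_FKS_solution_def using bounded f0 \<open>0 < v\<close>
    by (intro conjI ballI image_subsetI) auto
qed

text \<open>Evenness removes the inner absolute value, and the outer one absorbs the minus sign of
  the even equation.\<close>

lemma FKS2_solution_abs:
  assumes eps: "0 < eps" "eps < 1" and sol: "even_FKS_solution eps g"
  shows "FKS2_solution eps (\<lambda>x. \<bar>g x\<bar>)"
proof -
  have rng: "g x \<in> {-1..1}" and even: "g (- x) = g x"
    and eq: "g (g (eps\<^sup>2 * x)) = - eps * g x" if "x \<in> {-1..1}" for x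
    using sol that by (auto simp: even_FKS_solution_def image_subset_iff)
  have abs: "g \<bar>x\<bar> = g x" if "x \<in> {-1..1}" for x
    using even[OF that] by (simp add: abs_if)
  have "\<bar>g \<bar>g (eps\<^sup>2 * x)\<bar>\<bar> = eps * \<bar>g x\<bar>" if "x \<in> {0..1}" for x
  proof -
    \<comment> \<open>Evenness is available only on \<open>{-1..1}\<close>, so the inner value must
      be located there first.\<close>
    have "g (eps\<^sup>2 * x) \<in> {-1..1}"
      using FKS2_scaled_mem[OF eps that] by (intro rng) auto
    then show ?thesis using abs eq[of x] that eps by (auto simp: abs_mult)
  qed
  moreover have "\<bar>g x\<bar> \<le> 1" if "x \<in> {0..1}" for x
    using rng[of x] that by (auto simp: abs_le_iff)
  moreover have "g 0 = 1" using sol by (simp add: even_FKS_solution_def)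
  ultimately show ?thesis
    unfolding FKS2_solution_def by auto
qed

theorem theorem5p1:
  fixes eps :: real
  assumes "0 < eps" and "eps < 1"
  shows "(\<forall>f u v.
            single_valley_extended_platform_solution eps f \<longrightarrow>
            minimum_points f = {u..v} \<longrightarrow>
            f (eps\<^sup>2) < u \<longrightarrow>
            even_FKS_solution eps (\<lambda>x. sgn (v - \<bar>x\<bar>) * f \<bar>x\<bar>)) \<and>
         (\<forall>g. even_FKS_solution eps g \<longrightarrow> FKS2_solution eps (\<lambda>x. \<bar>g x\<bar>))"
  using even_FKS_solution_of_FKS2_solution[OF assms] FKS2_solution_abs[OF assms]
  by (auto simp: single_valley_extended_platform_solution_def)

end
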